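(* Let $n\ge 2$ and let $f(t)=\sum_{k\ge 0} f_k\,G_k^{(n)}(t)$ be a function on $[-1,1]$ with all $f_k\ge 0$, the series converging uniformly on $[-1,1]$. Then any $f$-design $P$ in $\mathbb{S}^{n-1}$ is an $M$-set in $\mathbb{S}^{n-1}$ with respect to $\rho(x,y)=-f(x\cdot y)$; that is, with $m=|P|$, $P\in M(\mathbb{S}^{n-1},\rho,m)$.
   Context: Gegenbauer polynomials: $G_0^{(n)}=1$, $G_1^{(n)}=t$, and $G_k^{(n)}=\frac{(2k+n-4)\,t\,G_{k-1}^{(n)}-(k-1)\,G_{k-2}^{(n)}}{k+n-3}$ for $k\ge 2$. For a finite nonempty set $P=\{p_1,\dots,p_m\}$ of unit vectors in $\mathbb{S}^{n-1}\subset\mathbb{R}^n$, put $M_k(P)=\sum_{i=1}^m\sum_{j=1}^m G_k^{(n)}(p_i\cdot p_j)$ and let $D(P)$ be the set of all inner products $p_i\cdot p_j$, $i\ne j$. Let $Z_f=\{t\in[-1,1): f(t)=0\}$. $P$ is an $f$-design if (1) $M_k(P)=0$ for all $k>0$ with $f_k\ne 0$, and (2) $D(P)\subset Z_f$. For a finite real sequence $A=(a_1,\dots,a_N)$ let $a_{(1)}\le\dots\le a_{(N)}$ be its elements in non-decreasing order. For real sequences $A,B$ of the same length $N$, write $A\vartriangleright B$ if $a_{(1)}+\dots+a_{(k)}\ge b_{(1)}+\dots+b_{(k)}$ for all $k=1,\dots,N$. $A$ and $B$ are incomparable if neither $A\vartriangleright B$ nor $B\vartriangleright A$. For a set $S$,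 a symmetric function $\rho:S\times S\to\mathbb{R}$ and $X=(x_1,\dots,x_m)\in S^m$, let $R_\rho(X)$ be the sequence of the $m(m-1)/2$ numbers $\rho(x_i,x_j)$, $1\le i<j\le m$ (with repetition). $X\in S^m$ is an $M$-set in $S$ with respect to $\rho$ if for every $Y\in S^m$ either $R_\rho(X)\vartriangleright R_\rho(Y)$, or $R_\rho(X)$ and $R_\rho(Y)$ are incomparable. $M(S,\rho,m)$ is the set of all $M$-sets $X\in S^m$; the order of the points is irrelevant. *)

theory Defs
  imports "HOL-Analysis.Analysis"
begin

text \<open>
  Gegenbauer polynomials \<open>G\<^sub>k\<close> for dimension \<open>n\<close>, normalised so that they take the value 1 at 1
  (for \<open>n \<ge> 2\<close>).
\<close>

fun gegenbauer :: "nat \<Rightarrow> nat \<Rightarrow> real \<Rightarrow> real" where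
  "gegenbauer n 0 t = 1"
| "gegenbauer n (Suc 0) t = t"
| "gegenbauer n (Suc (Suc k)) t =
     ((2 * real (k + 2) + real n - 4) * t * gegenbauer n (Suc k) t
        - (real (k + 2) - 1) * gegenbauer n k t) / (real (k + 2) + real n - 3)"

definition moment :: "nat \<Rightarrow> (real ^ 'n) set \<Rightarrow> real" where
  "moment k P = (\<Sum>x\<in>P. \<Sum>y\<in>P. gegenbauer CARD('n) k (x \<bullet> y))"

definition inner_products :: "(real ^ 'n) set \<Rightarrow> real set" where
  "inner_products P = {x \<bullet> y | x y. x \<in> P \<and> y \<in> P \<and> x \<noteq> y}"

definition zeros :: "(real \<Rightarrow> real) \<Rightarrow> real set" where
  "zeros f = {t \<in> {-1..<1}. f t = 0}"

text \<open>
  Only the values of \<open>f\<close> on \<open>[-1,1]\<close> matter.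
\<close>

definition gegenbauer_expansion :: "nat \<Rightarrow> (nat \<Rightarrow> real) \<Rightarrow> (real \<Rightarrow> real) \<Rightarrow> bool" where
  "gegenbauer_expansion n c f \<longleftrightarrow>
     uniform_limit {-1..1} (\<lambda>N t. \<Sum>k<N. c k * gegenbauer n k t) f sequentially"

text \<open>
  \<open>f\<close>-designs; \<open>c\<close> is meant to be the coefficient sequence of the Gegenbauer expansion of \<open>f\<close>.
\<close>

definition design :: "(nat \<Rightarrow> real) \<Rightarrow> (real \<Rightarrow> real) \<Rightarrow> (real ^ 'n) set \<Rightarrow> bool" where
  "design c f P \<longleftrightarrow>
     finite P \<and> P \<noteq> {} \<and> P \<subseteq> sphere 0 1 \<and>
     (\<forall>k>0. c k \<noteq> 0 \<longrightarrow> moment k P = 0) \<and>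
     inner_products P \<subseteq> zeros f"

definition dominates :: "real list \<Rightarrow> real list \<Rightarrow> bool" where
  "dominates A B \<longleftrightarrow>
     length A = length B \<and>
     (\<forall>k\<in>{1..length A}. sum_list (take k (sort A)) \<ge> sum_list (take k (sort B)))"

definition incomparable :: "real list \<Rightarrow> real list \<Rightarrow> bool" where
  "incomparable A B \<longleftrightarrow> \<not> dominates A B \<and> \<not> dominates B A"

definition pair_values :: "('a \<Rightarrow> 'a \<Rightarrow> real) \<Rightarrow> 'a list \<Rightarrow> real list" where
  "pair_values \<rho> X = [\<rho> (X ! i) (X ! j). i \<leftarrow> [0..<length X], j \<leftarrow> [Suc i..<length X]]"

text \<open>
  \<open>m\<close>-tuples of points of \<open>S\<close> are lists of length \<open>m\<close>, possibly with repetitions. For symmetric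
  \<open>\<rho>\<close>, membership does not depend on the order of the points.
\<close>

definition M_sets :: "'a set \<Rightarrow> ('a \<Rightarrow> 'a \<Rightarrow> real) \<Rightarrow> nat \<Rightarrow> 'a list set" where
  "M_sets S \<rho> m = {X. length X = m \<and> set X \<subseteq> S \<and>
     (\<forall>Y. length Y = m \<and> set Y \<subseteq> S \<longrightarrow>
        dominates (pair_values \<rho> X) (pair_values \<rho> Y) \<or>
        incomparable (pair_values \<rho> X) (pair_values \<rho> Y))}"

end

theory Submission imports Defs begin

text \<open>
  The pair values of an \<open>f\<close>-design are all \<open>0\<close>, because its inner products are zeros of \<open>f\<close>. So it
  suffices to show: if the pair values of an \<open>m\<close>-tuple \<open>Y\<close> of unit vectors dominate the zero sequence,
  then they all vanish, and the two sequences coincide. Domination already forces the smallest pair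
  value of \<open>Y\<close>, hence every one of them, to be nonnegative, that is, \<open>f (y\<^sub>i \<bullet> y\<^sub>j) \<le> 0\<close> for
  \<open>i \<noteq> j\<close>. On the other hand the energies \<open>\<Sum>i j. f (y\<^sub>i \<bullet> y\<^sub>j)\<close> are bounded below by
  \<open>c\<^sub>0 m\<^sup>2\<close> (\<open>gegenbauer_energy_ge\<close>), and the design attains this bound since the moments
  occurring in the expansion of \<open>f\<close> vanish (\<open>design_energy\<close>). The diagonal terms contribute
  \<open>m f(1)\<close> to both energies and are the whole energy of the design, so the off-diagonal terms of
  \<open>Y\<close> have a nonnegative sum. Being nonpositive, they are all zero.

  The lower bound rests on Schoenberg's theorem that \<open>G\<^sub>k (x \<bullet> y)\<close> is a positive semidefinite kernel
  on the sphere (\<open>gegenbauer_positive_definite\<close>). It is obtained without integrating over the sphere.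
  Extend \<open>x \<mapsto> G\<^sub>k (a \<bullet> x)\<close> from the sphere to a homogeneous polynomial \<open>Z\<^sub>a\<close> of degree \<open>k\<close>
  on the whole space; the three-term recursion shows that \<open>Z\<^sub>a\<close> is harmonic and, up to multiples of
  \<open>x \<bullet> x\<close>, a positive multiple of \<open>(a \<bullet> x)\<^sup>k\<close>. The Fischer form on polynomials is positive
  semidefinite, and in it multiplication by a linear form is adjoint to differentiation in that
  direction, up to the degree. Pairing a harmonic polynomial \<open>q\<close> with \<open>Z\<^sub>a\<close> therefore loses the
  multiples of \<open>x \<bullet> x\<close> and turns the remaining power of \<open>a \<bullet> x\<close> into the \<open>k\<close>-fold derivative of
  \<open>q\<close> in direction \<open>a\<close>, which is \<open>k! q(a)\<close>. So \<open>Z\<^sub>a\<close> reproduces values at \<open>a\<close> up to a positive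
  constant (\<open>fischer_solid_zonal\<close>), and the kernel is a Gram matrix up to that constant.
\<close>

section \<open>Directional derivatives of polynomial functions\<close>

definition dir_deriv :: "'a::euclidean_space \<Rightarrow> ('a \<Rightarrow> real) \<Rightarrow> 'a \<Rightarrow> real" where
  "dir_deriv v p x = frechet_derivative p (at x) v"

lemma dir_deriv_eqI:
  assumes "\<And>x. (p has_derivative p' x) (at x)"
  shows "dir_deriv v p = (\<lambda>x. p' x v)"
  unfolding dir_deriv_def using frechet_derivative_at[OF assms] by (simp add: fun_eq_iff)

lemma polynomial_has_derivative:
  fixes p :: "'a::euclidean_space \<Rightarrow> real"
  assumes "real_polynomial_function p"
  shows "(p has_derivative (\<lambda>v. dir_deriv v p x)) (at x)"
proof -
  have "p differentiable at x"
    using differentiable_at_polynomial_function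
    using assms real_polynomial_function_eq by blast
  then show ?thesis
    unfolding dir_deriv_def by (simp add: frechet_derivative_works)
qed

lemma dir_deriv_const: "dir_deriv v (\<lambda>x. c) = (\<lambda>x. 0)"
  by (rule dir_deriv_eqI) simp

lemma dir_deriv_linear: "bounded_linear p \<Longrightarrow> dir_deriv v p = (\<lambda>x. p v)"
  by (rule dir_deriv_eqI) (rule bounded_linear_imp_has_derivative)

lemma dir_deriv_add:
  assumes "real_polynomial_function p" "real_polynomial_function q"
  shows "dir_deriv v (\<lambda>x. p x + q x) = (\<lambda>x. dir_deriv v p x + dir_deriv v q x)"
  by (rule dir_deriv_eqI) (intro has_derivative_add polynomial_has_derivative assms)

lemma dir_deriv_mult:
  assumes "real_polynomial_function p" "real_polynomial_function q"
  shows "dir_deriv v (\<lambda>x. p x * q x) = (\<lambda>x. p x * dir_deriv v q x + dir_deriv v p x * q x)"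
  by (rule dir_deriv_eqI) (intro has_derivative_mult polynomial_has_derivative assms)

lemma dir_deriv_cmult:
  assumes "real_polynomial_function p"
  shows "dir_deriv v (\<lambda>x. c * p x) = (\<lambda>x. c * dir_deriv v p x)"
  using dir_deriv_mult[OF real_polynomial_function.intros(2) assms] by (simp add: dir_deriv_const)

lemma dir_deriv_sum:
  assumes "finite I" "\<And>i. i \<in> I \<Longrightarrow> real_polynomial_function (p i)"
  shows "dir_deriv v (\<lambda>x. \<Sum>i\<in>I. p i x) = (\<lambda>x. \<Sum>i\<in>I. dir_deriv v (p i) x)"
  by (rule dir_deriv_eqI) (intro has_derivative_sum polynomial_has_derivative assms)

lemma polynomial_inner [intro]: "real_polynomial_function (\<lambda>x::'a::euclidean_space. a \<bullet> x)"
  by (intro real_polynomial_function.intros(1) bounded_linear_inner_right)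

lemma polynomial_cmult [intro]:
  "real_polynomial_function p \<Longrightarrow> real_polynomial_function (\<lambda>x. c * p x)"
  by (intro real_polynomial_function.intros(2,4))

lemma polynomial_dir_deriv [intro]:
  assumes "real_polynomial_function p"
  shows "real_polynomial_function (dir_deriv v p)"
  using assms
  by induction
     (auto simp: dir_deriv_linear dir_deriv_const dir_deriv_add dir_deriv_mult
       intro!: real_polynomial_function.intros(2-4))

lemma dir_deriv_commute:
  assumes "real_polynomial_function p"
  shows "dir_deriv u (dir_deriv v p) = dir_deriv v (dir_deriv u p)"
  using assms
proof induction
  case (mult p q)
  then show ?case
    by (simp add: dir_deriv_mult dir_deriv_add polynomial_dir_deriv
        real_polynomial_function.intros algebra_simps)
qed (simp_all add: dir_deriv_linear dir_deriv_const dir_deriv_add polynomial_dir_deriv)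

text \<open>
  Sums over the standard basis arise from the Laplacian and the Fischer form; this collapses them
  to a derivative in a single direction.
\<close>

lemma dir_deriv_Basis_sum:
  assumes "real_polynomial_function p"
  shows "(\<Sum>i\<in>Basis. (v \<bullet> i) * dir_deriv i p x) = dir_deriv v p x"
proof -
  interpret bounded_linear "\<lambda>v. dir_deriv v p x"
    using polynomial_has_derivative[OF assms] by (rule has_derivative_bounded_linear)
  have "dir_deriv (\<Sum>i\<in>Basis. (v \<bullet> i) *\<^sub>R i) p x = (\<Sum>i\<in>Basis. (v \<bullet> i) * dir_deriv i p x)"
    by (simp add: sum scaleR)
  then show ?thesis by (simp add: euclidean_representation)
qed

lemma dir_deriv_inner: "dir_deriv v (\<lambda>x. a \<bullet> x) = (\<lambda>x. a \<bullet> v)"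
  by (rule dir_deriv_linear) (rule bounded_linear_inner_right)

lemma polynomial_inner_self [intro]: "real_polynomial_function (\<lambda>x::'a::euclidean_space. x \<bullet> x)"
  unfolding euclidean_inner[of x x for x]
  by (intro real_polynomial_function_sum real_polynomial_function.intros(4))
     (auto simp: inner_commute[of _ "i::'a" for i])

lemma dir_deriv_inner_self: "dir_deriv v (\<lambda>x. x \<bullet> x) = (\<lambda>x. 2 * (x \<bullet> v))"
  by (rule dir_deriv_eqI[where p' = "\<lambda>x v. 2 * (x \<bullet> v)"])
     (auto intro!: derivative_eq_intros simp: inner_commute)

section \<open>The Laplacian and the Euler operator\<close>

definition laplacian :: "('a::euclidean_space \<Rightarrow> real) \<Rightarrow> 'a \<Rightarrow> real" where
  "laplacian p x = (\<Sum>i\<in>Basis. dir_deriv i (dir_deriv i p) x)"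

text \<open>
  Homogeneity is expressed by Euler's identity, which is linear in \<open>p\<close> and can be differentiated.
\<close>

definition homogeneous :: "nat \<Rightarrow> ('a::euclidean_space \<Rightarrow> real) \<Rightarrow> bool" where
  "homogeneous k p \<longleftrightarrow> (\<forall>x. dir_deriv x p x = real k * p x)"

lemma laplacian_mult:
  assumes "real_polynomial_function p" "real_polynomial_function q"
  shows "laplacian (\<lambda>x. p x * q x) x =
    p x * laplacian q x + 2 * (\<Sum>i\<in>Basis. dir_deriv i p x * dir_deriv i q x) + laplacian p x * q x"
  using assms
  by (simp add: laplacian_def dir_deriv_mult dir_deriv_add polynomial_dir_deriv
        real_polynomial_function.intros sum.distrib sum_distrib_left sum_distrib_right algebra_simps)

lemma laplacian_add:
  assumes "real_polynomial_function p" "real_polynomial_function q"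
  shows "laplacian (\<lambda>x. p x + q x) = (\<lambda>x. laplacian p x + laplacian q x)"
  using assms by (simp add: laplacian_def fun_eq_iff dir_deriv_add polynomial_dir_deriv sum.distrib)

lemma laplacian_cmult:
  assumes "real_polynomial_function p"
  shows "laplacian (\<lambda>x. c * p x) = (\<lambda>x. c * laplacian p x)"
  using assms by (simp add: laplacian_def fun_eq_iff dir_deriv_cmult polynomial_dir_deriv sum_distrib_left)

lemma laplacian_sum:
  assumes "finite I" "\<And>i. i \<in> I \<Longrightarrow> real_polynomial_function (p i)"
  shows "laplacian (\<lambda>x. \<Sum>i\<in>I. p i x) x = (\<Sum>i\<in>I. laplacian (p i) x)"
  using assms
  by (simp add: laplacian_def dir_deriv_sum polynomial_dir_deriv sum.swap[of _ I])

lemma laplacian_inner_mult: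
  assumes "real_polynomial_function q"
  shows "laplacian (\<lambda>x. (a \<bullet> x) * q x) x = (a \<bullet> x) * laplacian q x + 2 * dir_deriv a q x"
  using assms
  by (simp add: laplacian_mult polynomial_inner dir_deriv_inner dir_deriv_Basis_sum)
     (simp add: laplacian_def dir_deriv_inner dir_deriv_const)

lemma laplacian_inner_self: "laplacian (\<lambda>x::'a::euclidean_space. x \<bullet> x) x = 2 * real DIM('a)"
proof -
  have "dir_deriv i (dir_deriv i (\<lambda>x::'a. x \<bullet> x)) x = 2 * (i \<bullet> i)" for i
    unfolding dir_deriv_inner_self
    by (subst inner_commute) (simp only: dir_deriv_cmult polynomial_inner dir_deriv_inner)
  then show ?thesis by (simp add: laplacian_def)
qed

lemma laplacian_inner_self_mult:
  fixes q :: "'a::euclidean_space \<Rightarrow> real"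
  assumes "real_polynomial_function q" "homogeneous k q"
  shows "laplacian (\<lambda>x. (x \<bullet> x) * q x) x =
    (x \<bullet> x) * laplacian q x + (2 * real DIM('a) + 4 * real k) * q x"
proof -
  have "(\<Sum>i\<in>Basis. dir_deriv i (\<lambda>x. x \<bullet> x) x * dir_deriv i q x) = 2 * dir_deriv x q x"
    using dir_deriv_Basis_sum[OF assms(1), of x x]
    by (simp add: dir_deriv_inner_self mult.assoc flip: sum_distrib_left)
  then show ?thesis
    using assms(2)
    by (subst laplacian_mult[OF polynomial_inner_self assms(1)])
       (simp add: laplacian_inner_self homogeneous_def algebra_simps)
qed

lemma laplacian_dir_deriv:
  assumes "real_polynomial_function p"
  shows "laplacian (dir_deriv v p) = dir_deriv v (laplacian p)"
proof -
  have "dir_deriv i (dir_deriv i (dir_deriv v p)) = dir_deriv v (dir_deriv i (dir_deriv i p))" for i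
    by (simp only: dir_deriv_commute[OF assms, of i v]
        dir_deriv_commute[OF polynomial_dir_deriv[OF assms], of i v])
  then show ?thesis
    using assms unfolding laplacian_def[abs_def] by (simp add: dir_deriv_sum polynomial_dir_deriv)
qed

lemma homogeneous_add:
  assumes "real_polynomial_function p" "real_polynomial_function q" "homogeneous k p" "homogeneous k q"
  shows "homogeneous k (\<lambda>x. p x + q x)"
  using assms by (simp add: homogeneous_def dir_deriv_add algebra_simps)

lemma homogeneous_cmult:
  assumes "real_polynomial_function p" "homogeneous k p"
  shows "homogeneous k (\<lambda>x. c * p x)"
  using assms by (simp add: homogeneous_def dir_deriv_cmult)

lemma homogeneous_sum:
  assumes "finite I" "\<And>i. i \<in> I \<Longrightarrow> real_polynomial_function (p i)" "\<And>i. i \<in> I \<Longrightarrow> homogeneous k (p i)"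
  shows "homogeneous k (\<lambda>x. \<Sum>i\<in>I. p i x)"
  using assms by (simp add: homogeneous_def dir_deriv_sum sum_distrib_left)

lemma homogeneous_mult:
  assumes "real_polynomial_function p" "real_polynomial_function q" "homogeneous j p" "homogeneous k q"
  shows "homogeneous (j + k) (\<lambda>x. p x * q x)"
  using assms by (simp add: homogeneous_def dir_deriv_mult algebra_simps)

text \<open>
  Differentiating Euler's identity in direction \<open>v\<close> produces one extra copy of \<open>dir_deriv v p\<close>,
  from the factor \<open>x\<close>; this is what lowers the degree by one.
\<close>

lemma homogeneous_dir_deriv:
  assumes p: "real_polynomial_function p" and hom: "homogeneous (Suc k) p"
  shows "homogeneous k (dir_deriv v p)"
  unfolding homogeneous_def
proof
  fix x
  have "(\<lambda>x. \<Sum>i\<in>Basis. (i \<bullet> x) * dir_deriv i p x) = (\<lambda>x. real (Suc k) * p x)"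
    using hom dir_deriv_Basis_sum[OF p] by (simp add: homogeneous_def inner_commute)
  then have "dir_deriv v (\<lambda>x. \<Sum>i\<in>Basis. (i \<bullet> x) * dir_deriv i p x) x = real (Suc k) * dir_deriv v p x"
    using p by (simp only: dir_deriv_cmult)
  moreover have "dir_deriv v (\<lambda>x. \<Sum>i\<in>Basis. (i \<bullet> x) * dir_deriv i p x) x =
      (\<Sum>i\<in>Basis. (x \<bullet> i) * dir_deriv i (dir_deriv v p) x) + (\<Sum>i\<in>Basis. (v \<bullet> i) * dir_deriv i p x)"
    using p by (simp add: dir_deriv_sum dir_deriv_mult polynomial_dir_deriv polynomial_inner
        real_polynomial_function.intros(4) dir_deriv_inner sum.distrib inner_commute dir_deriv_commute[of p v])
  ultimately show "dir_deriv x (dir_deriv v p) x = real k * dir_deriv v p x"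
    using p by (simp add: dir_deriv_Basis_sum polynomial_dir_deriv algebra_simps)
qed

text \<open>
  Euler's identity says that \<open>p\<close> has zero derivative along each open ray from the origin; continuity
  extends constancy to the origin itself.
\<close>

lemma homogeneous_0_imp_const:
  assumes p: "real_polynomial_function p" and hom: "homogeneous 0 p"
  shows "p x = p 0"
proof -
  have deriv: "((\<lambda>t. p (t *\<^sub>R x)) has_real_derivative dir_deriv x p (t *\<^sub>R x)) (at t)" for t
  proof -
    interpret bounded_linear "\<lambda>v. dir_deriv v p (t *\<^sub>R x)"
      using polynomial_has_derivative[OF p] by (rule has_derivative_bounded_linear)
    have "((\<lambda>t. p (t *\<^sub>R x)) has_derivative (\<lambda>s. dir_deriv (s *\<^sub>R x) p (t *\<^sub>R x))) (at t)"
      by (rule has_derivative_compose[OF _ polynomial_has_derivative[OF p]])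
         (auto intro!: derivative_eq_intros)
    then show ?thesis
      by (simp add: has_field_derivative_def scaleR mult_commute_abs)
  qed
  have "dir_deriv x p (t *\<^sub>R x) = 0" if "t > 0" for t
  proof -
    interpret bounded_linear "\<lambda>v. dir_deriv v p (t *\<^sub>R x)"
      using polynomial_has_derivative[OF p] by (rule has_derivative_bounded_linear)
    have "t * dir_deriv x p (t *\<^sub>R x) = 0"
      using hom scaleR[of t x] by (simp add: homogeneous_def)
    then show ?thesis using that by simp
  qed
  with deriv have zero: "((\<lambda>t. p (t *\<^sub>R x)) has_real_derivative 0) (at t)" if "t > 0" for t
    using that by metis
  have "continuous_on {0..1} (\<lambda>t. p (t *\<^sub>R x))"
    using deriv by (rule DERIV_continuous_on[OF has_field_derivative_at_within])
  then have "p (1 *\<^sub>R x) = p (0 *\<^sub>R x)"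
    by (rule DERIV_isconst_end[where f = "\<lambda>t. p (t *\<^sub>R x)", rotated]) (simp_all add: zero)
  then show ?thesis by simp
qed

section \<open>The Fischer form\<close>

text \<open>
  This is the sum of \<open>\<partial>\<^sub>I p(0) * \<partial>\<^sub>I q(0)\<close> over all index sequences \<open>I\<close> of length \<open>k\<close>. On
  homogeneous polynomials of degree \<open>k\<close> it is \<open>k!\<close> times the classical Fischer (apolar)
  inner product \<open>p(\<partial>) q\<close>. The recursion through gradients makes positivity evident.
\<close>

primrec fischer :: "nat \<Rightarrow> ('a::euclidean_space \<Rightarrow> real) \<Rightarrow> ('a \<Rightarrow> real) \<Rightarrow> real" where
  "fischer 0 p q = p 0 * q 0"
| "fischer (Suc k) p q = (\<Sum>i\<in>Basis. fischer k (dir_deriv i p) (dir_deriv i q))"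

lemma fischer_nonneg: "fischer k p p \<ge> 0"
  by (induction k arbitrary: p) (auto intro: sum_nonneg)

lemma fischer_commute: "fischer k p q = fischer k q p"
  by (induction k arbitrary: p q) (auto simp: mult.commute intro: sum.cong)

lemma fischer_zero: "fischer k (\<lambda>x. 0) q = 0"
  by (induction k arbitrary: q) (auto simp: dir_deriv_const)

lemma fischer_add:
  assumes "real_polynomial_function p" "real_polynomial_function q"
  shows "fischer k (\<lambda>x. p x + q x) r = fischer k p r + fischer k q r"
  using assms
  by (induction k arbitrary: p q r)
     (auto simp: dir_deriv_add polynomial_dir_deriv sum.distrib algebra_simps)

lemma fischer_cmult:
  assumes "real_polynomial_function p"
  shows "fischer k (\<lambda>x. c * p x) r = c * fischer k p r"
  using assms
  by (induction k arbitrary: p r)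
     (auto simp: dir_deriv_cmult polynomial_dir_deriv sum_distrib_left)

lemma fischer_sum:
  assumes "finite I" "\<And>i. i \<in> I \<Longrightarrow> real_polynomial_function (p i)"
  shows "fischer k (\<lambda>x. \<Sum>i\<in>I. p i x) r = (\<Sum>i\<in>I. fischer k (p i) r)"
  using assms
  by (induction I rule: finite_induct) (auto simp: fischer_zero fischer_add real_polynomial_function_sum)

lemma fischer_dir_deriv:
  assumes "real_polynomial_function q"
  shows "(\<Sum>i\<in>Basis. (v \<bullet> i) * fischer k p (dir_deriv i q)) = fischer k p (dir_deriv v q)"
proof -
  have "(\<Sum>i\<in>Basis. (v \<bullet> i) * fischer k p (dir_deriv i q)) =
      fischer k (\<lambda>x. \<Sum>i\<in>Basis. (v \<bullet> i) * dir_deriv i q x) p"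
    using assms
    by (simp add: fischer_sum fischer_cmult polynomial_cmult polynomial_dir_deriv fischer_commute[of k p])
  also have "\<dots> = fischer k (dir_deriv v q) p"
    using assms by (simp add: dir_deriv_Basis_sum)
  finally show ?thesis by (simp only: fischer_commute)
qed

text \<open>
  Induction on \<open>k\<close> with the product rule: each of the \<open>k + 1\<close> differentiations may be the one that
  hits the linear factor, and each such choice contributes \<open>fischer k p (dir_deriv v q)\<close>. The
  term in which the factor survives is discarded by evaluation at \<open>0\<close>.
\<close>

lemma fischer_inner_mult:
  assumes "real_polynomial_function p" "real_polynomial_function q"
  shows "fischer (Suc k) (\<lambda>x. (v \<bullet> x) * p x) q = real (Suc k) * fischer k p (dir_deriv v q)"
  using assms
proof (induction k arbitrary: p q)
  case 0
  then show ?case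
    by (simp add: dir_deriv_mult polynomial_inner dir_deriv_inner mult.assoc mult.left_commute
        dir_deriv_Basis_sum flip: sum_distrib_left)
next
  case (Suc k)
  have "fischer (Suc (Suc k)) (\<lambda>x. (v \<bullet> x) * p x) q =
      (\<Sum>i\<in>Basis. fischer (Suc k) (\<lambda>x. (v \<bullet> x) * dir_deriv i p x + (v \<bullet> i) * p x) (dir_deriv i q))"
    using Suc.prems by (subst fischer.simps) (simp only: dir_deriv_mult polynomial_inner dir_deriv_inner)
  also have "\<dots> = (\<Sum>i\<in>Basis. fischer (Suc k) (\<lambda>x. (v \<bullet> x) * dir_deriv i p x) (dir_deriv i q)) +
      (\<Sum>i\<in>Basis. (v \<bullet> i) * fischer (Suc k) p (dir_deriv i q))"
    using Suc.prems
    by (simp only: fischer_add fischer_cmult polynomial_inner polynomial_dir_deriv polynomial_cmult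
        real_polynomial_function.intros(4) sum.distrib)
  also have "(\<Sum>i\<in>Basis. fischer (Suc k) (\<lambda>x. (v \<bullet> x) * dir_deriv i p x) (dir_deriv i q)) =
      real (Suc k) * fischer (Suc k) p (dir_deriv v q)"
    using Suc by (simp only: Suc.IH polynomial_dir_deriv fischer.simps sum_distrib_left dir_deriv_commute[of q v])
  also have "(\<Sum>i\<in>Basis. (v \<bullet> i) * fischer (Suc k) p (dir_deriv i q)) = fischer (Suc k) p (dir_deriv v q)"
    using Suc.prems by (intro fischer_dir_deriv)
  finally show ?case by (simp add: algebra_simps del: fischer.simps)
qed

text \<open>
  Applying the adjointness twice for each coordinate, multiplication by \<open>x \<bullet> x\<close> is adjoint to the
  Laplacian up to a constant, which annihilates harmonic \<open>q\<close>.
\<close>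

lemma fischer_inner_self_mult:
  assumes p: "real_polynomial_function p" and q: "real_polynomial_function q"
    and harm: "laplacian q = (\<lambda>x. 0)"
  shows "fischer (Suc (Suc k)) (\<lambda>x. (x \<bullet> x) * p x) q = 0"
proof -
  have "(\<lambda>x. (x \<bullet> x) * p x) = (\<lambda>x. \<Sum>i\<in>Basis. (i \<bullet> x) * ((i \<bullet> x) * p x))"
    by (subst euclidean_inner) (simp add: sum_distrib_right inner_commute mult.assoc)
  then have "fischer (Suc (Suc k)) (\<lambda>x. (x \<bullet> x) * p x) q =
      (\<Sum>i\<in>Basis. fischer (Suc (Suc k)) (\<lambda>x. (i \<bullet> x) * ((i \<bullet> x) * p x)) q)"
    using p by (simp only: fischer_sum finite_Basis polynomial_inner real_polynomial_function.intros(4))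
  also have "\<dots> = (\<Sum>i\<in>Basis. real (Suc (Suc k)) * real (Suc k) * fischer k (dir_deriv i (dir_deriv i q)) p)"
    using p q by (simp only: fischer_inner_mult polynomial_inner real_polynomial_function.intros(4)
        polynomial_dir_deriv fischer_commute[of k p] mult.assoc)
  also have "\<dots> = real (Suc (Suc k)) * real (Suc k) * fischer k (laplacian q) p"
    unfolding laplacian_def[abs_def] using q
    by (simp only: fischer_sum finite_Basis polynomial_dir_deriv sum_distrib_left)
  finally show ?thesis by (simp add: harm fischer_zero)
qed

section \<open>Solid zonal harmonics\<close>

text \<open>
  The homogeneous extension of \<open>x \<mapsto> G\<^sub>k (a \<bullet> x)\<close> from the unit sphere, for a unit vector \<open>a\<close>: the
  Gegenbauer recursion with its last term multiplied by \<open>x \<bullet> x\<close> to equalise the degrees.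
\<close>

fun solid_zonal :: "nat \<Rightarrow> 'a::euclidean_space \<Rightarrow> 'a \<Rightarrow> real" where
  "solid_zonal 0 a = (\<lambda>x. 1)"
| "solid_zonal (Suc 0) a = (\<lambda>x. a \<bullet> x)"
| "solid_zonal (Suc (Suc k)) a = (\<lambda>x.
     (2 * real (k + 2) + real DIM('a) - 4) / (real (k + 2) + real DIM('a) - 3)
       * ((a \<bullet> x) * solid_zonal (Suc k) a x)
     + - ((real (k + 2) - 1) / (real (k + 2) + real DIM('a) - 3))
       * ((x \<bullet> x) * solid_zonal k a x))"

lemma solid_zonal_on_sphere:
  fixes a :: "'a::euclidean_space"
  assumes "norm x = 1"
  shows "solid_zonal k a x = gegenbauer DIM('a) k (a \<bullet> x)"
  using assms
  by (induction k a rule: solid_zonal.induct)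
     (simp_all add: dot_square_norm diff_divide_distrib)

lemma polynomial_solid_zonal [intro]: "real_polynomial_function (solid_zonal k a)"
  by (induction k a rule: solid_zonal.induct)
     (auto intro!: real_polynomial_function.intros(2-) polynomial_inner polynomial_inner_self)

lemma homogeneous_solid_zonal: "homogeneous k (solid_zonal k a)"
proof (induction k a rule: solid_zonal.induct)
  case (3 k a)
  have "homogeneous 1 (\<lambda>x. a \<bullet> x)" "homogeneous 2 (\<lambda>x::'a. x \<bullet> x)"
    by (simp_all add: homogeneous_def dir_deriv_inner dir_deriv_inner_self)
  then have "homogeneous (1 + Suc k) (\<lambda>x. (a \<bullet> x) * solid_zonal (Suc k) a x)"
    "homogeneous (2 + k) (\<lambda>x. (x \<bullet> x) * solid_zonal k a x)"
    using 3 by (simp_all only: homogeneous_mult polynomial_inner polynomial_inner_self polynomial_solid_zonal)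
  then show ?case
    unfolding solid_zonal.simps
    by (intro homogeneous_add homogeneous_cmult polynomial_cmult real_polynomial_function.intros(4)
        polynomial_inner polynomial_inner_self polynomial_solid_zonal) simp_all
qed (simp_all add: homogeneous_def dir_deriv_const dir_deriv_inner)

lemma dir_deriv_solid_zonal_Suc_Suc:
  fixes a :: "'a::euclidean_space"
  defines "d k \<equiv> real (k + 2) + real DIM('a) - 3"
  shows "dir_deriv a (solid_zonal (Suc (Suc k)) a) x =
    (2 * real (k + 2) + real DIM('a) - 4) / d k *
      ((a \<bullet> x) * dir_deriv a (solid_zonal (Suc k) a) x + (a \<bullet> a) * solid_zonal (Suc k) a x)
    - (real (k + 2) - 1) / d k *
      ((x \<bullet> x) * dir_deriv a (solid_zonal k a) x + 2 * (a \<bullet> x) * solid_zonal k a x)"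
  unfolding solid_zonal.simps d_def
  by (simp only: dir_deriv_add dir_deriv_cmult dir_deriv_mult polynomial_cmult
      real_polynomial_function.intros(4) polynomial_inner polynomial_inner_self polynomial_solid_zonal
      dir_deriv_inner dir_deriv_inner_self)
     (simp add: inner_commute)

text \<open>
  The derivative towards the pole lowers the order, in the same way as for the powers of a linear
  form. Differentiating the recursion expresses the left-hand side by the zonal polynomials of the
  three preceding orders, and by the recursion itself these combine to the claimed multiple.
\<close>

lemma dir_deriv_solid_zonal:
  fixes a :: "'a::euclidean_space"
  assumes dim: "DIM('a) \<ge> 2" and a: "norm a = 1"
  shows "dir_deriv a (solid_zonal (Suc k) a) x = real (Suc k) * solid_zonal k a x"
proof (induction k rule: less_induct)
  case (less k)
  have aa: "a \<bullet> a = 1" using a by (simp add: dot_square_norm)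
  consider "k = 0" | "k = 1" | j where "k = Suc (Suc j)"
    by (metis One_nat_def not0_implies_Suc)
  then show ?case
  proof cases
    case 1
    then show ?thesis by (simp add: dir_deriv_inner aa)
  next
    case 2
    have "real DIM('a) - 1 \<noteq> 0" using dim by simp
    then show ?thesis
      unfolding 2 One_nat_def dir_deriv_solid_zonal_Suc_Suc
      by (simp add: aa dir_deriv_inner dir_deriv_const divide_simps) (simp add: algebra_simps)
  next
    case (3 j)
    define z1 z0 where "z1 = solid_zonal (Suc j) a x" and "z0 = solid_zonal j a x"
    define n where "n = real DIM('a)"
    have n: "n \<ge> 2" using dim by (simp add: n_def)
    have nz: "real j + n - 1 \<noteq> 0" "real j + n \<noteq> 0" using n by auto
    have d1: "dir_deriv a (solid_zonal (Suc (Suc j)) a) x = (real j + 2) * z1"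
      using less.IH[of "Suc j"] 3 by (simp add: z1_def)
    have d0: "dir_deriv a (solid_zonal (Suc j) a) x = (real j + 1) * z0"
      using less.IH[of j] 3 by (simp add: z0_def)
    have coeffs: "2 * real (Suc j + 2) + real DIM('a) - 4 = 2 * real j + 2 + n"
      "real (Suc j + 2) + real DIM('a) - 3 = real j + n" "real (Suc j + 2) - 1 = real j + 2"
      by (simp_all add: n_def)
    have z2: "solid_zonal (Suc (Suc j)) a x =
       ((2 * real j + n) * (a \<bullet> x) * z1 - (real j + 1) * (x \<bullet> x) * z0) / (real j + n - 1)"
      by (simp add: z1_def z0_def n_def diff_divide_distrib algebra_simps)
    have "dir_deriv a (solid_zonal (Suc (Suc (Suc j))) a) x =
       ((2 * real j + 2 + n) * ((a \<bullet> x) * ((real j + 2) * z1) + solid_zonal (Suc (Suc j)) a x)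
        - (real j + 2) * ((x \<bullet> x) * ((real j + 1) * z0) + 2 * (a \<bullet> x) * z1)) / (real j + n)"
      unfolding z1_def[symmetric] coeffs
      by (subst dir_deriv_solid_zonal_Suc_Suc, unfold d1 d0 aa coeffs z1_def[symmetric])
         (simp only: times_divide_eq_left diff_divide_distrib mult_1 mult.assoc)
    also have "\<dots> = (real j + 3) * solid_zonal (Suc (Suc j)) a x"
      unfolding z2 using nz by (simp add: divide_simps) (simp add: algebra_simps)
    finally show ?thesis unfolding 3 by simp
  qed
qed

text \<open>
  In the recursion, the Laplacian of the first term is twice a derivative towards the pole, and that
  of the second is an Euler term. Both are multiples of \<open>solid_zonal k a\<close>, and the coefficients of
  the Gegenbauer recursion are exactly those for which they cancel.
\<close>

lemma laplacian_solid_zonal: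
  fixes a :: "'a::euclidean_space"
  assumes dim: "DIM('a) \<ge> 2" and a: "norm a = 1"
  shows "laplacian (solid_zonal k a) = (\<lambda>x. 0)"
  using a
proof (induction k a rule: solid_zonal.induct)
  case (3 k a)
  show ?case
  proof
    fix x
    have "laplacian (\<lambda>x. (a \<bullet> x) * solid_zonal (Suc k) a x) x = 2 * (real (Suc k) * solid_zonal k a x)"
      using 3 dir_deriv_solid_zonal[OF dim, of a k]
      by (simp add: laplacian_inner_mult polynomial_solid_zonal)
    moreover have "laplacian (\<lambda>x. (x \<bullet> x) * solid_zonal k a x) x =
        (2 * real DIM('a) + 4 * real k) * solid_zonal k a x"
      using 3 by (simp add: laplacian_inner_self_mult[OF polynomial_solid_zonal homogeneous_solid_zonal])
    ultimately show "laplacian (solid_zonal (Suc (Suc k)) a) x = 0"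
      unfolding solid_zonal.simps
      by (simp only: laplacian_add laplacian_cmult polynomial_cmult real_polynomial_function.intros(4)
        polynomial_inner polynomial_inner_self polynomial_solid_zonal) (simp add: algebra_simps add_divide_distrib)
  qed
qed (simp_all add: laplacian_def[abs_def] dir_deriv_const dir_deriv_inner)

section \<open>Positive definiteness of the Gegenbauer kernels\<close>

text \<open>
  Zonal harmonics are reproducing for the Fischer form. By the recursion, \<open>solid_zonal (Suc k) a\<close> is
  a multiple of \<open>(a \<bullet> x) * solid_zonal k a x\<close> plus a multiple of \<open>x \<bullet> x\<close>. The latter is orthogonal
  to harmonic \<open>q\<close>; the former moves one derivative in direction \<open>a\<close> onto \<open>q\<close>, which stays harmonic
  and loses one degree, so that the induction hypothesis applies, and Euler's identity at \<open>a\<close> recovers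
  \<open>q a\<close>. The constant is positive because the leading coefficients of the recursion are, in dimension
  at least \<open>2\<close>.
\<close>

lemma fischer_solid_zonal:
  assumes dim: "DIM('a::euclidean_space) \<ge> 2"
  shows "\<exists>C>0. \<forall>a q. real_polynomial_function q \<longrightarrow> homogeneous k q \<longrightarrow>
    laplacian q = (\<lambda>x::'a. 0) \<longrightarrow> fischer k (solid_zonal k a) q = C * q a"
proof (induction k)
  case 0
  then show ?case
    by (intro exI[of _ 1]) (simp, metis homogeneous_0_imp_const)
next
  case (Suc k)
  then obtain C where C: "C > 0" and IH: "\<And>a q. real_polynomial_function q \<Longrightarrow> homogeneous k q \<Longrightarrow>
    laplacian q = (\<lambda>x::'a. 0) \<Longrightarrow> fischer k (solid_zonal k a) q = C * q a"
    by metis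
  \<comment> \<open>\<open>A\<close> is the leading coefficient of the step from order \<open>k\<close> to \<open>k + 1\<close>; the step to order 1 does
    not come from the recursion and has coefficient 1.\<close>
  define \<alpha> where "\<alpha> = (2 * real (k + 1) + real DIM('a) - 4) / (real (k + 1) + real DIM('a) - 3)"
  define A where "A = (if k = 0 then 1 else \<alpha>)"
  have "A > 0" using dim by (auto simp: A_def \<alpha>_def divide_simps)
  have "fischer (Suc k) (solid_zonal (Suc k) a) q = A * real (Suc k) * real (Suc k) * C * q a"
    if q: "real_polynomial_function q" "homogeneous (Suc k) q" "laplacian q = (\<lambda>x. 0)" for q and a :: 'a
  proof -
    have "fischer (Suc k) (solid_zonal (Suc k) a) q =
        A * fischer (Suc k) (\<lambda>x. (a \<bullet> x) * solid_zonal k a x) q"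
    proof (cases k)
      case 0
      then show ?thesis by (simp add: A_def)
    next
      case (Suc j)
      then show ?thesis
        unfolding Suc solid_zonal.simps(3)
        using q by (subst fischer_add)
          (simp_all only: fischer_cmult polynomial_cmult real_polynomial_function.intros(4)
           polynomial_inner polynomial_inner_self polynomial_solid_zonal
           fischer_inner_self_mult A_def \<alpha>_def, simp add: Suc)
    qed
    also have "\<dots> = A * (real (Suc k) * fischer k (solid_zonal k a) (dir_deriv a q))"
      using q by (simp only: fischer_inner_mult polynomial_solid_zonal)
    also have "fischer k (solid_zonal k a) (dir_deriv a q) = C * dir_deriv a q a"
      using q by (intro IH polynomial_dir_deriv homogeneous_dir_deriv)
        (auto simp: laplacian_dir_deriv dir_deriv_const)
    also have "dir_deriv a q a = real (Suc k) * q a"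
      using q by (simp add: homogeneous_def)
    finally show ?thesis by simp
  qed
  with \<open>A > 0\<close> C show ?case
    by (intro exI[of _ "A * real (Suc k) * real (Suc k) * C"]) auto
qed

text \<open>
  With \<open>q\<close> the sum of the zonal harmonics at the points \<open>y i\<close>, the reproducing property turns the
  double sum into a positive multiple of \<open>fischer k q q\<close>.
\<close>

lemma gegenbauer_positive_definite:
  fixes y :: "'b \<Rightarrow> 'a::euclidean_space"
  assumes dim: "DIM('a) \<ge> 2" and I: "finite I" and y: "\<And>i. i \<in> I \<Longrightarrow> norm (y i) = 1"
  shows "(\<Sum>i\<in>I. \<Sum>j\<in>I. gegenbauer DIM('a) k (y i \<bullet> y j)) \<ge> 0"
proof -
  obtain C where C: "C > 0" and reproducing: "\<And>a q. real_polynomial_function q \<Longrightarrow> homogeneous k q \<Longrightarrow>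
    laplacian q = (\<lambda>x::'a. 0) \<Longrightarrow> fischer k (solid_zonal k a) q = C * q a"
    using fischer_solid_zonal[OF dim] by metis
  define q where "q = (\<lambda>x. \<Sum>j\<in>I. solid_zonal k (y j) x)"
  have "laplacian q = (\<lambda>x. 0)"
    unfolding q_def using I y
    by (simp add: fun_eq_iff laplacian_sum polynomial_solid_zonal laplacian_solid_zonal[OF dim])
  moreover have "real_polynomial_function q" "homogeneous k q"
    unfolding q_def using I by (auto intro: homogeneous_sum homogeneous_solid_zonal)
  ultimately have rep: "fischer k (solid_zonal k a) q = C * q a" for a
    by (intro reproducing)
  have "0 \<le> fischer k q q" by (rule fischer_nonneg)
  also have "\<dots> = (\<Sum>i\<in>I. fischer k (solid_zonal k (y i)) q)"
    unfolding q_def using I by (intro fischer_sum) auto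
  also have "\<dots> = C * (\<Sum>i\<in>I. q (y i))"
    by (simp add: rep sum_distrib_left)
  also have "(\<Sum>i\<in>I. q (y i)) = (\<Sum>i\<in>I. \<Sum>j\<in>I. gegenbauer DIM('a) k (y i \<bullet> y j))"
    unfolding q_def using y by (simp add: solid_zonal_on_sphere inner_commute)
  finally show ?thesis using C by (simp add: zero_le_mult_iff)
qed

section \<open>Energies of designs\<close>

lemma gegenbauer_energy_LIMSEQ:
  assumes exp: "gegenbauer_expansion n c f" and y: "\<And>i. i \<in> I \<Longrightarrow> norm (y i) = 1"
  shows "(\<lambda>N. \<Sum>k<N. c k * (\<Sum>i\<in>I. \<Sum>j\<in>I. gegenbauer n k (y i \<bullet> y j)))
    \<longlonglongrightarrow> (\<Sum>i\<in>I. \<Sum>j\<in>I. f (y i \<bullet> y j))"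
proof -
  have "(\<lambda>N. \<Sum>i\<in>I. \<Sum>j\<in>I. \<Sum>k<N. c k * gegenbauer n k (y i \<bullet> y j))
      \<longlonglongrightarrow> (\<Sum>i\<in>I. \<Sum>j\<in>I. f (y i \<bullet> y j))"
  proof (intro tendsto_sum)
    fix i j assume "i \<in> I" "j \<in> I"
    then have "\<bar>y i \<bullet> y j\<bar> \<le> 1" using Cauchy_Schwarz_ineq2[of "y i" "y j"] y by simp
    then show "(\<lambda>N. \<Sum>k<N. c k * gegenbauer n k (y i \<bullet> y j)) \<longlonglongrightarrow> f (y i \<bullet> y j)"
      using exp unfolding gegenbauer_expansion_def by (intro tendsto_uniform_limitI) auto
  qed
  moreover have "(\<Sum>i\<in>I. \<Sum>j\<in>I. \<Sum>k<N. c k * gegenbauer n k (y i \<bullet> y j)) =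
      (\<Sum>k<N. c k * (\<Sum>i\<in>I. \<Sum>j\<in>I. gegenbauer n k (y i \<bullet> y j)))" for N
    by (simp add: sum_distrib_left sum.swap[of _ "{..<N}"])
  ultimately show ?thesis by simp
qed

text \<open>
  By positive definiteness and \<open>c k \<ge> 0\<close>, dropping all terms of the expansion except the constant
  one can only decrease the energy.
\<close>

lemma gegenbauer_energy_ge:
  fixes y :: "'b \<Rightarrow> 'a::euclidean_space"
  assumes dim: "DIM('a) \<ge> 2" and c: "\<And>k. c k \<ge> 0" and exp: "gegenbauer_expansion DIM('a) c f"
    and I: "finite I" and y: "\<And>i. i \<in> I \<Longrightarrow> norm (y i) = 1"
  shows "(\<Sum>i\<in>I. \<Sum>j\<in>I. f (y i \<bullet> y j)) \<ge> c 0 * (real (card I))\<^sup>2"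
proof (rule LIMSEQ_le_const[OF gegenbauer_energy_LIMSEQ[OF exp y]])
  let ?M = "\<lambda>k. \<Sum>i\<in>I. \<Sum>j\<in>I. gegenbauer DIM('a) k (y i \<bullet> y j)"
  have "c 0 * (real (card I))\<^sup>2 \<le> (\<Sum>k<N. c k * ?M k)" if N: "N \<ge> 1" for N
  proof -
    have "c 0 * (real (card I))\<^sup>2 = (\<Sum>k\<in>{0}. c k * ?M k)"
      by (simp add: power2_eq_square)
    also have "\<dots> \<le> (\<Sum>k<N. c k * ?M k)"
      using N c gegenbauer_positive_definite[OF dim I y] by (intro sum_mono2) auto
    finally show ?thesis .
  qed
  then show "\<exists>N. \<forall>n\<ge>N. c 0 * (real (card I))\<^sup>2 \<le> (\<Sum>k<n. c k * ?M k)" by blast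
qed

lemma design_energy:
  fixes P :: "(real ^ 'n) set"
  assumes exp: "gegenbauer_expansion CARD('n) c f" and design: "design c f P"
  shows "(\<Sum>x\<in>P. \<Sum>y\<in>P. f (x \<bullet> y)) = c 0 * (real (card P))\<^sup>2"
proof (rule LIMSEQ_unique)
  show "(\<lambda>N. \<Sum>k<N. c k * moment k P) \<longlonglongrightarrow> (\<Sum>x\<in>P. \<Sum>y\<in>P. f (x \<bullet> y))"
    unfolding moment_def using design
    by (intro gegenbauer_energy_LIMSEQ[OF exp]) (auto simp: design_def)
  have "(\<Sum>k<N. c k * moment k P) = c 0 * (real (card P))\<^sup>2" if "N \<ge> 1" for N
  proof -
    have "(\<Sum>k<N. c k * moment k P) = (\<Sum>k\<in>{0}. c k * moment k P)"
      using that design by (intro sum.mono_neutral_right) (auto simp: design_def)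
    then show ?thesis by (simp add: moment_def power2_eq_square)
  qed
  then show "(\<lambda>N. \<Sum>k<N. c k * moment k P) \<longlonglongrightarrow> c 0 * (real (card P))\<^sup>2"
    by (intro tendsto_eventually eventually_sequentiallyI[of 1]) auto
qed

lemma design_energy_diagonal:
  assumes design: "design c f P"
  shows "(\<Sum>x\<in>P. \<Sum>y\<in>P. f (x \<bullet> y)) = real (card P) * f 1"
proof -
  have "(\<Sum>y\<in>P. f (x \<bullet> y)) = f 1" if x: "x \<in> P" for x
  proof -
    have "f (x \<bullet> y) = 0" if "y \<in> P - {x}" for y
      using design x that unfolding design_def inner_products_def zeros_def by blast
    then have "(\<Sum>y\<in>P. f (x \<bullet> y)) = (\<Sum>y\<in>{x}. f (x \<bullet> y))"
      using design x by (intro sum.mono_neutral_right) (auto simp: design_def)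
    also have "norm x = 1" using design x by (auto simp: design_def)
    then have "(\<Sum>y\<in>{x}. f (x \<bullet> y)) = f 1" by (simp add: dot_square_norm)
    finally show ?thesis .
  qed
  then show ?thesis by simp
qed

section \<open>Pair values and dominance\<close>

lemma sum_list_concat_map: "sum_list (concat (map f xs)) = (\<Sum>x\<leftarrow>xs. sum_list (f x))"
  by (induction xs) auto

lemma length_pair_values: "length (pair_values \<rho> X) = (\<Sum>i\<leftarrow>[0..<length X]. length X - Suc i)"
  by (simp add: pair_values_def length_concat comp_def)

lemma sum_list_pair_values:
  "sum_list (pair_values \<rho> X) = (\<Sum>i<length X. \<Sum>j\<in>{i<..<length X}. \<rho> (X ! i) (X ! j))"
proof -
  have "sum_list (pair_values \<rho> X) =
    (\<Sum>i\<leftarrow>[0..<length X]. \<Sum>j\<leftarrow>[Suc i..<length X]. \<rho> (X ! i) (X ! j))"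
    by (simp add: pair_values_def sum_list_concat_map)
  then show ?thesis
    by (simp add: interv_sum_list_conv_sum_set_nat atLeast0LessThan atLeastSucLessThan_greaterThanLessThan)
qed

lemma sum_square_eq_pair_values:
  assumes sym: "\<And>x y. g x y = g y x"
  shows "(\<Sum>i<length X. \<Sum>j<length X. g (X ! i) (X ! j)) =
    (\<Sum>i<length X. g (X ! i) (X ! i)) + 2 * sum_list (pair_values g X)"
proof -
  let ?m = "length X" and ?g = "\<lambda>i j. g (X ! i) (X ! j)"
  have split: "(\<Sum>j<?m. ?g i j) = ?g i i + (\<Sum>j\<in>{i<..<?m}. ?g i j) + (\<Sum>j<i. ?g i j)" if "i < ?m" for i
  proof -
    have "{..<?m} = insert i ({i<..<?m} \<union> {..<i})" using that by auto
    then show ?thesis by (simp add: sum.union_disjoint Int_def add.assoc)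
  qed
  have "(\<Sum>i<?m. \<Sum>j<i. ?g i j) = (\<Sum>j<?m. \<Sum>i\<in>{j<..<?m}. ?g i j)"
    by (simp add: sum.Sigma, rule sum.reindex_bij_witness[of _ "\<lambda>(a, b). (b, a)" "\<lambda>(a, b). (b, a)"]) auto
  also have "\<dots> = sum_list (pair_values g X)"
    by (simp add: sum_list_pair_values sym)
  finally show ?thesis
    by (simp add: split sum.distrib sum_list_pair_values)
qed

text \<open>
  The first partial sum is the minimum of \<open>A\<close>.
\<close>

lemma dominates_zeros_imp_nonneg:
  assumes "dominates A (replicate N 0)" "a \<in> set A"
  shows "a \<ge> 0"
proof (cases "sort A")
  case Nil
  then show ?thesis using assms(2) by (metis set_sort set_empty empty_iff)
next
  case (Cons b B)
  have "sum_list (take 1 (sort A)) \<ge> sum_list (take 1 (sort (replicate N (0::real))))"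
    using assms unfolding dominates_def by (metis atLeastAtMost_iff length_pos_if_in_set less_one linorder_not_le order_refl)
  moreover have "sort (replicate N (0::real)) = replicate N 0"
    by (simp add: sorted_sort_id)
  ultimately have "b \<ge> 0" by (simp add: Cons sum_list_replicate)
  moreover have "a \<in> set (b # B)" "sorted (b # B)"
    using assms(2) by (metis Cons set_sort) (metis Cons sorted_sort)
  ultimately show ?thesis by auto
qed

theorem theorem6p2:
  fixes P :: "(real ^ 'n) set" and X :: "(real ^ 'n) list"
    and c :: "nat \<Rightarrow> real" and f :: "real \<Rightarrow> real"
  assumes "CARD('n) \<ge> 2"
    and "\<And>k. c k \<ge> 0"
    and "gegenbauer_expansion CARD('n) c f"
    and "design c f P"
    and "distinct X" and "set X = P"
  shows "X \<in> M_sets (sphere 0 1) (\<lambda>x y. - f (x \<bullet> y)) (card P)"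
proof -
  let ?\<rho> = "\<lambda>x y::real^'n. - f (x \<bullet> y)"
  let ?R = "pair_values ?\<rho>"
  have len: "length X = card P" using assms(5,6) distinct_card by fastforce
  have "v = 0" if "v \<in> set (?R X)" for v
  proof -
    from that obtain i j where v: "v = - f (X ! i \<bullet> X ! j)" and ij: "i < j" "j < length X"
      unfolding pair_values_def by auto
    have "X ! i \<bullet> X ! j \<in> inner_products P"
      using ij assms(5,6) unfolding inner_products_def
      by (auto simp: nth_eq_iff_index_eq intro!: exI nth_mem)
    then show ?thesis using assms(4) v by (auto simp: design_def zeros_def)
  qed
  then have RX: "?R X = replicate (length (?R X)) 0"
    by (simp add: replicate_eqI)
  have "dominates (?R X) (?R Y)"
    if Y: "length Y = card P" "set Y \<subseteq> sphere 0 1" and dom: "dominates (?R Y) (?R X)" for Y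
  proof -
    have unit: "norm (Y ! i) = 1" if "i < length Y" for i
      using Y(2) that by (auto simp: subset_iff)
    have nonneg: "v \<ge> 0" if "v \<in> set (?R Y)" for v
      using dom that RX dominates_zeros_imp_nonneg by metis
    have "real (length Y) * f 1 = c 0 * (real (length Y))\<^sup>2"
      using design_energy[OF assms(3,4)] design_energy_diagonal[OF assms(4)] Y(1) by simp
    also have "\<dots> \<le> (\<Sum>i<length Y. \<Sum>j<length Y. f (Y ! i \<bullet> Y ! j))"
      using gegenbauer_energy_ge[where 'a = "real^'n", of c f "{..<length Y}" "\<lambda>i. Y ! i"] assms(1-3) unit by simp
    also have "\<dots> = - (\<Sum>i<length Y. \<Sum>j<length Y. ?\<rho> (Y ! i) (Y ! j))"
      by (simp add: sum_negf)
    also have "\<dots> = (\<Sum>i<length Y. f (Y ! i \<bullet> Y ! i)) - 2 * sum_list (?R Y)"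
      by (subst sum_square_eq_pair_values) (simp_all add: inner_commute sum_negf)
    also have "(\<Sum>i<length Y. f (Y ! i \<bullet> Y ! i)) = real (length Y) * f 1"
      by (simp add: unit dot_square_norm)
    finally have "sum_list (?R Y) \<le> 0" by simp
    with nonneg have "\<forall>v\<in>set (?R Y). v = 0"
      by (metis antisym sum_list_nonneg sum_list_nonneg_eq_0_iff)
    then have "?R Y = replicate (length (?R Y)) 0"
      by (simp add: replicate_eqI)
    moreover have "length (?R Y) = length (?R X)"
      using Y(1) len by (simp add: length_pair_values)
    ultimately have "?R Y = ?R X" using RX by metis
    then show ?thesis by (simp add: dominates_def)
  qed
  moreover have "set X \<subseteq> sphere 0 1" using assms(4,6) by (auto simp: design_def)
  ultimately show ?thesis
    unfolding M_sets_def incomparable_def using len by auto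
qed

end
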